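(* Let $F=(f_1,\ldots,f_m)^\top:\mathbb{R}^n\to\mathbb{R}^m$ be continuously differentiable, let $s\in\mathbb{N}$ with $1\le s<n$, and let $\Omega=\{x\in\mathbb{R}^n\mid \|x\|_0\le s\}$. Assume that $F$ is component-wise convex, i.e. each $f_j$ is convex on $\mathbb{R}^n$. Let $L>0$ and let $\bar x\in\Omega$ be an $L$-stationary point for the problem $\min_{x\in\Omega}F(x)$. Then $\bar x$ is locally weakly Pareto optimal for this problem.
   Context: $\|x\|_0$ denotes the number of nonzero components of $x$, and $\|\cdot\|$ is the Euclidean norm. For $u,v\in\mathbb{R}^m$, $u<v$ means $u_j<v_j$ for all $j\in\{1,\ldots,m\}$. $L$-stationarity: for $L>0$ and $\bar x\in\Omega$ let $\mathcal{D}_L(\bar x)=\{v\in\mathbb{R}^n\mid \bar x+v\in\Omega\}$ and $$\theta_L(\bar x)=\min_{d\in\mathcal{D}_L(\bar x)}\ \max_{j=1,\ldots,m}\nabla f_j(\bar x)^\top d+\frac{L}{2}\|d\|^2 .$$ The point $\bar x\in\Omega$ is $L$-stationary if $\theta_L(\bar x)=0$. A point $\bar x\in\Omega$ is locally weakly Pareto optimal if there exists a neighborhood $\mathcal{N}(\bar x)$ of $\bar x$ such that there is no $y\in\Omega\cap\mathcal{N}(\bar x)$ with $F(y)<F(\bar x)$. *)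

theory Defs
  imports "HOL-Analysis.Analysis"
begin

definition grad :: "('a::real_inner \<Rightarrow> real) \<Rightarrow> 'a \<Rightarrow> 'a" where
  "grad f x = (THE D. GDERIV f x :> D)"

lemma grad_eqI:
  assumes "GDERIV f x :> D"
  shows "grad f x = D"
  unfolding grad_def
proof (rule the_equality)
  fix D' assume "GDERIV f x :> D'"
  then have "(\<lambda>h. h \<bullet> D') = (\<lambda>h. h \<bullet> D)"
    using assms unfolding gderiv_def by (rule has_derivative_unique)
  then have "\<forall>h. h \<bullet> D' = h \<bullet> D"
    by (rule fun_cong [THEN allI])
  then show "D' = D"
    by (simp only: vector_eq_ldot)
qed (rule assms)

definition continuously_differentiable ::
    "('a::real_normed_vector \<Rightarrow> 'b::real_normed_vector) \<Rightarrow> bool" where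
  "continuously_differentiable F \<longleftrightarrow>
    (\<exists>F' :: 'a \<Rightarrow> 'a \<Rightarrow>\<^sub>L 'b.
      (\<forall>x. (F has_derivative blinfun_apply (F' x)) (at x)) \<and> continuous_on UNIV F')"

definition l0_norm :: "real ^ 'n \<Rightarrow> nat" where
  "l0_norm x = card {i. x $ i \<noteq> 0}"

definition sparse_set :: "nat \<Rightarrow> (real ^ 'n) set" where
  "sparse_set s = {x. l0_norm x \<le> s}"

text \<open>The library order on \<^typ>\<open>real ^ 'm\<close> makes \<open>u < v\<close> mean \<open>u \<le> v\<close> and \<open>u \<noteq> v\<close>, so the relation
  that is strict in every component needs a name of its own.\<close>

definition vec_less :: "real ^ 'm \<Rightarrow> real ^ 'm \<Rightarrow> bool" where
  "vec_less u v \<longleftrightarrow> (\<forall>j. u $ j < v $ j)"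

definition locally_weakly_pareto ::
    "(real ^ 'n \<Rightarrow> real ^ 'm) \<Rightarrow> (real ^ 'n) set \<Rightarrow> real ^ 'n \<Rightarrow> bool" where
  "locally_weakly_pareto F \<Omega> x \<longleftrightarrow>
    x \<in> \<Omega> \<and> (\<exists>N. open N \<and> x \<in> N \<and> \<not> (\<exists>y \<in> \<Omega> \<inter> N. vec_less (F y) (F x)))"

definition feasible_dirs :: "(real ^ 'n) set \<Rightarrow> real ^ 'n \<Rightarrow> (real ^ 'n) set" where
  "feasible_dirs \<Omega> x = {v. x + v \<in> \<Omega>}"

text \<open>The minimum over the feasible directions is rendered by \<open>INF\<close>; it is attained whenever \<open>\<Omega>\<close>
  is closed, \<open>x \<in> \<Omega>\<close> and \<open>L > 0\<close> (lemma \<open>theta_attained\<close>).\<close>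

definition theta :: "(real ^ 'n \<Rightarrow> real ^ 'm) \<Rightarrow> (real ^ 'n) set \<Rightarrow> real \<Rightarrow> real ^ 'n \<Rightarrow> real" where
  "theta F \<Omega> L x =
    (INF d \<in> feasible_dirs \<Omega> x.
      (MAX j. grad (\<lambda>z. F z $ j) x \<bullet> d) + L / 2 * (norm d)\<^sup>2)"

definition L_stationary :: "(real ^ 'n \<Rightarrow> real ^ 'm) \<Rightarrow> (real ^ 'n) set \<Rightarrow> real \<Rightarrow> real ^ 'n \<Rightarrow> bool" where
  "L_stationary F \<Omega> L x \<longleftrightarrow> x \<in> \<Omega> \<and> theta F \<Omega> L x = 0"

lemma closed_sparse_set: "closed (sparse_set s :: (real ^ 'n) set)"
proof -
  have "sparse_set s = (\<Union>I \<in> {I :: 'n set. card I \<le> s}. \<Inter>i \<in> - I. {x :: real ^ 'n. x $ i = 0})"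
    (is "_ = ?R")
  proof (intro equalityI subsetI)
    fix x :: "real ^ 'n" assume "x \<in> sparse_set s"
    then have "card {i. x $ i \<noteq> 0} \<le> s"
      by (simp add: sparse_set_def l0_norm_def)
    moreover have "x \<in> (\<Inter>i \<in> - {i. x $ i \<noteq> 0}. {x. x $ i = 0})"
      by auto
    ultimately show "x \<in> ?R"
      by blast
  next
    fix x :: "real ^ 'n" assume "x \<in> ?R"
    then obtain I where I: "card I \<le> s" "\<forall>i \<in> - I. x $ i = 0"
      by auto
    have "card {i. x $ i \<noteq> 0} \<le> card I"
      by (rule card_mono) (use I in auto)
    with I show "x \<in> sparse_set s"
      by (simp add: sparse_set_def l0_norm_def)
  qed
  moreover have "closed {x :: real ^ 'n. x $ i = 0}" for i
    by (intro closed_Collect_eq continuous_intros)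
  ultimately show ?thesis
    by (simp add: closed_UN closed_INT)
qed

lemma continuous_on_Max_range:
  fixes g :: "'m::finite \<Rightarrow> 'a::topological_space \<Rightarrow> real"
  assumes "\<And>j. continuous_on S (g j)"
  shows "continuous_on S (\<lambda>x. MAX j. g j x)"
proof -
  have "continuous_on S (\<lambda>x. Max ((\<lambda>j. g j x) ` J))" if "finite J" "J \<noteq> {}" for J
    using that
  proof (induction rule: finite_ne_induct)
    case (insert j J)
    then have "(\<lambda>x. Max ((\<lambda>j. g j x) ` insert j J)) = (\<lambda>x. max (g j x) (Max ((\<lambda>j. g j x) ` J)))"
      by simp
    then show ?case
      using assms insert by (simp add: continuous_on_max)
  qed (simp add: assms)
  then show ?thesis
    by simp
qed

lemma theta_attained:
  fixes F :: "real ^ 'n \<Rightarrow> real ^ 'm"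
  assumes "closed \<Omega>" "x \<in> \<Omega>" "L > 0"
  defines "\<phi> \<equiv> \<lambda>d. (MAX j. grad (\<lambda>z. F z $ j) x \<bullet> d) + L / 2 * (norm d)\<^sup>2"
  shows "\<exists>d \<in> feasible_dirs \<Omega> x. theta F \<Omega> L x = \<phi> d \<and> (\<forall>e \<in> feasible_dirs \<Omega> x. \<phi> d \<le> \<phi> e)"
proof -
  let ?g = "\<lambda>j. grad (\<lambda>z. F z $ j) x"
  let ?D = "feasible_dirs \<Omega> x"
  fix j0 :: 'm
  define R where "R = 2 * norm (?g j0) / L"
  have R: "R \<ge> 0"
    using assms by (simp add: R_def)
  have zero: "0 \<in> ?D" "\<phi> 0 = 0"
    using assms by (simp_all add: feasible_dirs_def \<phi>_def)
  have "?D = (\<lambda>v. x + v) -` \<Omega>"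
    by (auto simp: feasible_dirs_def)
  moreover have "closed ((\<lambda>v. x + v) -` \<Omega>)"
    by (intro closed_vimage assms continuous_intros)
  ultimately have "closed ?D"
    by (simp only:)
  then have "compact (?D \<inter> cball 0 R)"
    by (rule closed_Int_compact) (rule compact_cball)
  moreover have "continuous_on (?D \<inter> cball 0 R) \<phi>"
    unfolding \<phi>_def by (intro continuous_intros continuous_on_Max_range)
  moreover have "?D \<inter> cball 0 R \<noteq> {}"
    using zero R by auto
  ultimately obtain d where d: "d \<in> ?D \<inter> cball 0 R" "\<forall>e \<in> ?D \<inter> cball 0 R. \<phi> d \<le> \<phi> e"
    using continuous_attains_inf by blast
  have min: "\<phi> d \<le> \<phi> e" if "e \<in> ?D" for e
  proof (cases "norm e \<le> R")
    case True
    with d that show ?thesis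
      by auto
  next
    case False
    have "\<phi> d \<le> 0"
      using d zero R by force
    also have "0 \<le> norm e * (L / 2 * norm e - norm (?g j0))"
    proof (rule mult_nonneg_nonneg)
      show "0 \<le> L / 2 * norm e - norm (?g j0)"
        using False assms(3) by (simp add: R_def field_simps)
    qed simp
    also have "\<dots> = - (norm (?g j0) * norm e) + L / 2 * (norm e)\<^sup>2"
      by (simp add: algebra_simps power2_eq_square)
    also have "\<dots> \<le> ?g j0 \<bullet> e + L / 2 * (norm e)\<^sup>2"
      using Cauchy_Schwarz_ineq2[of "?g j0" e] by linarith
    also have "\<dots> \<le> \<phi> e"
      unfolding \<phi>_def by (intro add_right_mono Max_ge) auto
    finally show ?thesis .
  qed
  have "theta F \<Omega> L x = (INF e \<in> ?D. \<phi> e)"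
    by (simp add: theta_def \<phi>_def)
  also have "\<dots> = \<phi> d"
    using d min by (intro cInf_eq_minimum) auto
  finally show ?thesis
    using d min by blast
qed

end

theory Submission
  imports Defs
begin

text \<open>Points near \<open>xbar\<close> keep every nonzero component of \<open>xbar\<close>. Hence for a feasible \<open>y\<close> near
  \<open>xbar\<close> the whole line through \<open>xbar\<close> and \<open>y\<close> stays in the sparse set. If \<open>F y\<close> were strictly
  below \<open>F xbar\<close>, the gradient inequality for convex functions would make \<open>d = y - xbar\<close> a common
  descent direction, and a short multiple of \<open>d\<close> would make the objective of \<open>theta\<close> negative.\<close>

text \<open>\<open>grad\<close> is a definite description, so it means something only once a
  gradient exists; differentiability of \<open>F\<close> supplies one for each component.\<close>

lemma GDERIV_grad_component:
  fixes F :: "'a::euclidean_space \<Rightarrow> real ^ 'm"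
  assumes "continuously_differentiable F"
  shows "GDERIV (\<lambda>z. F z $ j) x :> grad (\<lambda>z. F z $ j) x"
proof -
  obtain F' where "(F has_derivative blinfun_apply (F' x)) (at x)"
    using assms unfolding continuously_differentiable_def by blast
  then have deriv: "((\<lambda>z. F z $ j) has_derivative (\<lambda>h. blinfun_apply (F' x) h $ j)) (at x)"
    by (rule bounded_linear.has_derivative[OF bounded_linear_vec_nth])
  \<comment> \<open>The vector representing the linear functional
    \<open>h \<mapsto> F' x h $ j\<close>: its adjoint, evaluated at 1.\<close>
  define D where "D = adjoint (\<lambda>h. blinfun_apply (F' x) h $ j) 1"
  have "blinfun_apply (F' x) h $ j = h \<bullet> D" for h
    using adjoint_works[OF has_derivative_linear[OF deriv], of h 1] by (simp add: D_def)
  with deriv have "GDERIV (\<lambda>z. F z $ j) x :> D"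
    by (simp add: gderiv_def)
  then show ?thesis
    by (simp add: grad_eqI)
qed

text \<open>Restricting \<open>f\<close> to the line through \<open>x\<close> and \<open>y\<close>
  reduces this to the tangent inequality in one variable, used between the parameters 0 and
  1.\<close>

lemma convex_gradient_le:
  fixes f :: "'a::real_inner \<Rightarrow> real"
  assumes "convex_on UNIV f" and "GDERIV f x :> D"
  shows "D \<bullet> (y - x) \<le> f y - f x"
proof -
  define g where "g = (\<lambda>t. f (x + t *\<^sub>R (y - x)))"
  have convex: "convex_on UNIV g"
  proof (rule convex_onI)
    fix t a b :: real assume t: "0 < t" "t < 1"
    have "x + ((1 - t) *\<^sub>R a + t *\<^sub>R b) *\<^sub>R (y - x)
      = (1 - t) *\<^sub>R (x + a *\<^sub>R (y - x)) + t *\<^sub>R (x + b *\<^sub>R (y - x))"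
      by (simp add: algebra_simps)
    with convex_onD[OF assms(1), of t] t
    show "g ((1 - t) *\<^sub>R a + t *\<^sub>R b) \<le> (1 - t) * g a + t * g b"
      by (simp add: g_def)
  qed simp
  have "((\<lambda>t. x + t *\<^sub>R (y - x)) has_derivative (\<lambda>t. t *\<^sub>R (y - x))) (at 0)"
    by (auto intro!: derivative_eq_intros)
  from has_derivative_compose[OF this, of f "\<lambda>h. h \<bullet> D"] assms(2)
  have "(g has_derivative (\<lambda>t. (t *\<^sub>R (y - x)) \<bullet> D)) (at 0)"
    by (simp add: g_def gderiv_def)
  then have "(g has_real_derivative D \<bullet> (y - x)) (at 0)"
    by (simp add: has_field_derivative_def inner_commute mult_commute_abs)
  with convex have "g 1 - g 0 \<ge> (D \<bullet> (y - x)) * (1 - 0)"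
    by (intro convex_on_imp_above_tangent[where A = UNIV]) auto
  then show ?thesis
    by (simp add: g_def)
qed

text \<open>A real \<open>INF\<close> is a lower bound only for a set bounded below; attainment of
  the minimum settles this, so any feasible \<open>d\<close> can be tested.\<close>

lemma theta_le:
  fixes F :: "real ^ 'n \<Rightarrow> real ^ 'm"
  assumes "closed \<Omega>" "x \<in> \<Omega>" "L > 0" "x + d \<in> \<Omega>"
    and "\<And>j. grad (\<lambda>z. F z $ j) x \<bullet> d \<le> m"
  shows "theta F \<Omega> L x \<le> m + L / 2 * (norm d)\<^sup>2"
proof -
  have "theta F \<Omega> L x \<le> (MAX j. grad (\<lambda>z. F z $ j) x \<bullet> d) + L / 2 * (norm d)\<^sup>2"
    using theta_attained[OF assms(1-3), of F] assms(4) by (auto simp: feasible_dirs_def)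
  moreover have "(MAX j. grad (\<lambda>z. F z $ j) x \<bullet> d) \<le> m"
    using assms(5) by simp
  ultimately show ?thesis
    by linarith
qed

text \<open>Where \<open>y\<close> vanishes, so does \<open>x\<close>, and hence every point of the
  line; its support lies in that of \<open>y\<close>.\<close>

lemma sparse_set_line:
  assumes "y \<in> sparse_set s" and "\<And>i. x $ i \<noteq> 0 \<Longrightarrow> y $ i \<noteq> 0"
  shows "x + t *\<^sub>R (y - x) \<in> sparse_set s"
proof -
  have "card {i. (x + t *\<^sub>R (y - x)) $ i \<noteq> 0} \<le> card {i. y $ i \<noteq> 0}"
    by (rule card_mono) (use assms(2) in force)+
  with assms(1) show ?thesis
    by (simp add: sparse_set_def l0_norm_def)
qed

lemma quadratic_negative_somewhere:
  fixes m q :: real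
  assumes "m < 0" "q \<ge> 0"
  obtains t where "t > 0" "t * m + q * t\<^sup>2 < 0"
proof
  \<comment> \<open>With this choice \<open>m + q * ?t\<close> equals \<open>m / (q + 1)\<close>;
    the added 1 keeps the denominator positive when \<open>q = 0\<close>.\<close>
  let ?t = "- m / (q + 1)"
  show pos: "?t > 0"
    using assms by (simp add: divide_neg_pos)
  have "m + q * ?t < 0"
    using assms by (simp add: field_simps)
  with pos have "?t * (m + q * ?t) < 0"
    by (rule mult_pos_neg)
  then show "?t * m + q * ?t\<^sup>2 < 0"
    by (simp only: power2_eq_square distrib_left mult_ac)
qed

theorem corollary2:
  fixes F :: "real ^ 'n \<Rightarrow> real ^ 'm"
    and s :: nat and L :: real and xbar :: "real ^ 'n"
  assumes "continuously_differentiable F"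
    and "1 \<le> s" and "s < CARD('n)"
    and "\<And>j. convex_on UNIV (\<lambda>x. F x $ j)"
    and "L > 0"
    and "xbar \<in> sparse_set s"
    and "L_stationary F (sparse_set s) L xbar"
  shows "locally_weakly_pareto F (sparse_set s) xbar"
proof -
  \<comment> \<open>The points whose support contains that of \<open>xbar\<close>; open as a finite
    intersection of open sets.\<close>
  define N where "N = (\<Inter>i \<in> {i. xbar $ i \<noteq> 0}. {y :: real ^ 'n. y $ i \<noteq> 0})"
  have "open N"
    unfolding N_def by (intro open_INT ballI open_Collect_neq continuous_intros) simp
  moreover have "xbar \<in> N"
    by (simp add: N_def)
  moreover have False if y: "y \<in> sparse_set s" "y \<in> N" and less: "vec_less (F y) (F xbar)" for y
  proof -
    define d where "d = y - xbar"
    \<comment> \<open>Finitely many negative differences have a negative maximum, which bounds all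
      directional derivatives along \<open>d\<close> at once.\<close>
    define m where "m = (MAX j. F y $ j - F xbar $ j)"
    have "m < 0"
      using less by (simp add: m_def vec_less_def)
    then obtain t where t: "t > 0" "t * m + (L / 2 * (norm d)\<^sup>2) * t\<^sup>2 < 0"
      using quadratic_negative_somewhere[of m "L / 2 * (norm d)\<^sup>2"] \<open>L > 0\<close> by auto
    have "grad (\<lambda>z. F z $ j) xbar \<bullet> d \<le> m" for j
    proof -
      have "grad (\<lambda>z. F z $ j) xbar \<bullet> d \<le> F y $ j - F xbar $ j"
        unfolding d_def by (intro convex_gradient_le GDERIV_grad_component assms)
      also have "\<dots> \<le> m"
        by (simp add: m_def)
      finally show ?thesis .
    qed
    then have "grad (\<lambda>z. F z $ j) xbar \<bullet> (t *\<^sub>R d) \<le> t * m" for j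
      using t(1) by simp
    moreover have "xbar + t *\<^sub>R d \<in> sparse_set s"
      using y unfolding d_def by (intro sparse_set_line) (auto simp: N_def)
    ultimately have "theta F (sparse_set s) L xbar \<le> t * m + L / 2 * (norm (t *\<^sub>R d))\<^sup>2"
      using assms by (intro theta_le closed_sparse_set)
    also have "\<dots> < 0"
      using t(2) by (simp add: power_mult_distrib mult_ac)
    finally show False
      using assms(7) by (simp add: L_stationary_def)
  qed
  ultimately show ?thesis
    using assms(6) unfolding locally_weakly_pareto_def by blast
qed

end
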